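(* Let $I$ be a radical ideal of a domain $D$. If either $D$ is a Pr\"ufer domain or $D$ is a torsion-free valuation ring, then $$\omega_{D[[X]]}(I[[X]])=\omega_{D[X]}(I[X])=\omega_D(I).$$
   Context: All rings are commutative with identity. A ring $(R,+,\cdot)$ is torsion-free if $(R,+)$ is a torsion-free abelian group. An ideal $I$ is radical if $I=\sqrt{I}$. $X$ is an indeterminate; $I[X]$ (resp. $I[[X]]$) denotes the ideal of the polynomial ring $D[X]$ (resp. of the power series ring $D[[X]]$) consisting of all elements whose coefficients all lie in $I$. For a positive integer $n$, a proper ideal $I$ of a ring $R$ is $n$-absorbing if whenever $r_1\cdots r_{n+1}\in I$ with $r_1,\ldots,r_{n+1}\in R$, there are $n$ of the $r_i$'s whose product is in $I$. If $I$ is $n$-absorbing for some positive integer $n$, then $\omega_R(I)=\min\{n : I \text{ is an } n\text{-absorbing ideal of } R\}$; otherwise $\omega_R(I)=\infty$. *)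

theory Defs
  imports
    "HOL-Library.Extended_Nat"
    "HOL-Computational_Algebra.Computational_Algebra"
begin

lemma module_mult: "module ((*) :: 'a::comm_ring_1 \<Rightarrow> 'a \<Rightarrow> 'a)"
  by unfold_locales (simp_all add: algebra_simps)

definition is_ideal :: "'a::comm_ring_1 set \<Rightarrow> bool" where
  "is_ideal I \<longleftrightarrow> module.subspace (*) I"

lemma is_ideal_iff:
  "is_ideal I \<longleftrightarrow> 0 \<in> I \<and> (\<forall>x\<in>I. \<forall>y\<in>I. x + y \<in> I) \<and> (\<forall>r. \<forall>x\<in>I. r * x \<in> I)"
  unfolding is_ideal_def module.subspace_def[OF module_mult] by blast

definition ideal_generated :: "'a::comm_ring_1 set \<Rightarrow> 'a set" where
  "ideal_generated S = module.span (*) S"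

definition radical :: "'a::comm_ring_1 set \<Rightarrow> 'a set" where
  "radical I = {x. \<exists>n::nat. n > 0 \<and> x ^ n \<in> I}"

definition radical_ideal :: "'a::comm_ring_1 set \<Rightarrow> bool" where
  "radical_ideal I \<longleftrightarrow> is_ideal I \<and> radical I = I"

definition poly_ideal :: "'a::comm_ring_1 set \<Rightarrow> 'a poly set" where
  "poly_ideal I = {p. \<forall>i. coeff p i \<in> I}"

definition fps_ideal :: "'a::comm_ring_1 set \<Rightarrow> 'a fps set" where
  "fps_ideal I = {f. \<forall>i. fps_nth f i \<in> I}"

definition n_absorbing :: "nat \<Rightarrow> 'a::comm_ring_1 set \<Rightarrow> bool" where
  "n_absorbing n I \<longleftrightarrow> n > 0 \<and> is_ideal I \<and> I \<noteq> UNIV \<and>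
     (\<forall>r :: nat \<Rightarrow> 'a. (\<Prod>i\<in>{1..n+1}. r i) \<in> I \<longrightarrow>
        (\<exists>S. S \<subseteq> {1..n+1} \<and> card S = n \<and> (\<Prod>i\<in>S. r i) \<in> I))"

text \<open>The improper ideal is not \<open>n\<close>-absorbing for any \<open>n\<close>, so its value is \<open>\<infinity>\<close>.\<close>

definition omega :: "'a::comm_ring_1 set \<Rightarrow> enat" where
  "omega I = (if \<exists>n. n_absorbing n I then enat (LEAST n. n_absorbing n I) else \<infinity>)"

definition fract_scale :: "'a::idom \<Rightarrow> 'a fract \<Rightarrow> 'a fract" where
  "fract_scale a x = to_fract a * x"

lemma module_fract_scale: "module (fract_scale :: 'a::idom \<Rightarrow> 'a fract \<Rightarrow> 'a fract)"
  by unfold_locales (simp_all add: fract_scale_def algebra_simps)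

definition fractional_ideal :: "'a::idom fract set \<Rightarrow> bool" where
  "fractional_ideal J \<longleftrightarrow> module.subspace fract_scale J \<and>
     (\<exists>d. d \<noteq> 0 \<and> fract_scale d ` J \<subseteq> range to_fract)"

definition fractional_ideal_mult :: "'a::idom fract set \<Rightarrow> 'a fract set \<Rightarrow> 'a fract set" where
  "fractional_ideal_mult J K = module.span fract_scale {x * y | x y. x \<in> J \<and> y \<in> K}"

definition invertible_fractional_ideal :: "'a::idom fract set \<Rightarrow> bool" where
  "invertible_fractional_ideal J \<longleftrightarrow> fractional_ideal J \<and>
     (\<exists>K. fractional_ideal K \<and> fractional_ideal_mult J K = range to_fract)"

definition prufer_domain :: "'a::idom itself \<Rightarrow> bool" where
  "prufer_domain _ \<longleftrightarrow>
     (\<forall>S :: 'a set. finite S \<and> ideal_generated S \<noteq> {0} \<longrightarrow>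
        invertible_fractional_ideal (to_fract ` ideal_generated S))"

definition valuation_ring :: "'a::idom itself \<Rightarrow> bool" where
  "valuation_ring _ \<longleftrightarrow>
     (\<forall>x :: 'a fract. x \<noteq> 0 \<longrightarrow> x \<in> range to_fract \<or> inverse x \<in> range to_fract)"

text \<open>Torsion-freeness of the additive group; \<open>of_nat n * x\<close> is the \<open>n\<close>-fold sum of \<open>x\<close>.\<close>

definition torsion_free :: "'a::comm_ring_1 itself \<Rightarrow> bool" where
  "torsion_free _ \<longleftrightarrow> (\<forall>n::nat. \<forall>x::'a. n > 0 \<and> of_nat n * x = 0 \<longrightarrow> x = 0)"

end

theory Submission
  imports Defs
begin

text \<open>
  For a radical ideal \<open>I\<close> of any commutative ring, being \<open>n\<close>-absorbing means being an
  intersection of at most \<open>n\<close> prime ideals, and this description passes from \<open>I\<close> to \<open>I[[X]]\<close>.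

  Call a set orthogonal modulo \<open>I\<close> if it avoids \<open>I\<close> while the product of any two
  distinct members lies in \<open>I\<close>; if \<open>I\<close> is the intersection of finitely many primes,
  an orthogonal set has at most as many members as there are primes. When \<open>I\<close> is radical and
  \<open>n\<close>-absorbing, an orthogonal set has at most \<open>n\<close> members, because for \<open>n + 1\<close>
  members the \<open>n + 1\<close> sums omitting one of them have their product in \<open>I\<close>, while no \<open>n\<close> of
  these sums do (\<open>card_orthogonal_le\<close>). For an orthogonal set \<open>A\<close> of largest size, no member of \<open>A\<close> can be
  split in two and no new member can be added; the first fact says that the colon ideals
  \<open>(I : a)\<close> with \<open>a \<in> A\<close> are prime, the second that they intersect in \<open>I\<close>
  (\<open>radical_n_absorbing_Inter_primes\<close>).

  The power series with coefficients in a prime ideal form a prime ideal, so \<open>I[[X]]\<close> is also an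
  intersection of at most \<open>n\<close> primes and therefore \<open>n\<close>-absorbing
  (\<open>Inter_primes_n_absorbing\<close>). Since \<open>I[X]\<close> and \<open>I\<close> are successive preimages
  of \<open>I[[X]]\<close> under \<open>D \<rightarrow> D[X] \<rightarrow> D[[X]]\<close>, and preimages of \<open>n\<close>-absorbing ideals are
  \<open>n\<close>-absorbing, the three ideals are \<open>n\<close>-absorbing for the same \<open>n\<close>.
\<close>

section \<open>Ideals and prime ideals\<close>

lemma ideal_zero: "is_ideal I \<Longrightarrow> 0 \<in> I"
  and ideal_add: "is_ideal I \<Longrightarrow> x \<in> I \<Longrightarrow> y \<in> I \<Longrightarrow> x + y \<in> I"
  and ideal_mult_left: "is_ideal I \<Longrightarrow> x \<in> I \<Longrightarrow> r * x \<in> I"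
  by (simp_all add: is_ideal_iff)

lemma ideal_mult_right: "is_ideal I \<Longrightarrow> x \<in> I \<Longrightarrow> x * r \<in> I"
  using ideal_mult_left[of I x r] by (simp add: mult.commute)

lemma ideal_diff: "is_ideal I \<Longrightarrow> x \<in> I \<Longrightarrow> y \<in> I \<Longrightarrow> x - y \<in> I"
  using ideal_add[of I x "-1 * y"] ideal_mult_left[of I y "-1"] by simp

lemma ideal_sum: "is_ideal I \<Longrightarrow> (\<And>x. x \<in> A \<Longrightarrow> f x \<in> I) \<Longrightarrow> sum f A \<in> I"
  unfolding is_ideal_def by (rule module.subspace_sum[OF module_mult])

lemma ideal_one_notin: "is_ideal I \<Longrightarrow> I \<noteq> UNIV \<Longrightarrow> 1 \<notin> I"
  using ideal_mult_left[of I 1] by auto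

lemma ideal_prod: "is_ideal I \<Longrightarrow> finite A \<Longrightarrow> a \<in> A \<Longrightarrow> f a \<in> I \<Longrightarrow> prod f A \<in> I"
  by (simp add: prod.remove ideal_mult_right)

lemma radical_ideal_is_ideal: "radical_ideal I \<Longrightarrow> is_ideal I"
  by (simp add: radical_ideal_def)

lemma radical_ideal_powerD: "radical_ideal I \<Longrightarrow> x ^ n \<in> I \<Longrightarrow> n > 0 \<Longrightarrow> x \<in> I"
  unfolding radical_ideal_def radical_def by blast

definition is_prime_ideal :: "'a::comm_ring_1 set \<Rightarrow> bool" where
  "is_prime_ideal P \<longleftrightarrow> is_ideal P \<and> P \<noteq> UNIV \<and> (\<forall>x y. x * y \<in> P \<longrightarrow> x \<in> P \<or> y \<in> P)"

lemma prime_ideal_prodD: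
  assumes "is_prime_ideal P" and "finite A" and "prod f A \<in> P"
  shows "\<exists>a\<in>A. f a \<in> P"
  using assms(2,3)
proof (induction A rule: finite_induct)
  case empty
  then show ?case
    using assms(1) ideal_one_notin by (auto simp: is_prime_ideal_def)
next
  case (insert a A)
  then show ?case
    using assms(1) by (auto simp: is_prime_ideal_def)
qed

text \<open>Each prime in the family needs only one factor of a product, so that at most as many
  factors as there are primes are needed in total.\<close>

lemma Inter_primes_n_absorbing:
  fixes F :: "'a::comm_ring_1 set set"
  assumes "finite F" and "F \<noteq> {}" and "card F \<le> n" and prime: "\<And>P. P \<in> F \<Longrightarrow> is_prime_ideal P"
  shows "n_absorbing n (\<Inter>F)"
proof -
  have ideal: "is_ideal P" if "P \<in> F" for P
    using prime[OF that] by (simp add: is_prime_ideal_def)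
  have "card F > 0"
    using assms by (simp add: card_gt_0_iff)
  then have "n > 0"
    using assms by simp
  moreover have "is_ideal (\<Inter>F)"
    using ideal by (fastforce simp: is_ideal_iff)
  moreover have "\<Inter>F \<noteq> UNIV"
    using assms(2) prime by (fastforce simp: is_prime_ideal_def)
  moreover have "\<exists>S\<subseteq>{1..n+1}. card S = n \<and> prod r S \<in> \<Inter>F"
    if r: "prod r {1..n+1} \<in> \<Inter>F" for r :: "nat \<Rightarrow> 'a"
  proof -
    have "\<exists>i\<in>{1..n+1}. r i \<in> P" if "P \<in> F" for P
      using r that by (intro prime_ideal_prodD prime) auto
    then obtain k where k: "\<And>P. P \<in> F \<Longrightarrow> k P \<in> {1..n+1} \<and> r (k P) \<in> P"
      by metis
    have "card (k ` F) \<le> n"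
      using card_image_le[OF assms(1), of k] assms(3) by simp
    moreover have "k ` F \<subseteq> {1..n+1}"
      using k by blast
    ultimately obtain S where S: "k ` F \<subseteq> S" "S \<subseteq> {1..n+1}" "card S = n"
      using exists_subset_between[of "k ` F" n "{1..n+1}"] by auto
    have "finite S"
      using S(2) finite_subset by blast
    then have "prod r S \<in> P" if "P \<in> F" for P
      using that S(1) k ideal by (intro ideal_prod[of P S "k P"]) auto
    with S show ?thesis
      by blast
  qed
  ultimately show ?thesis
    by (simp add: n_absorbing_def)
qed

section \<open>Orthogonal sets modulo a radical ideal\<close>

definition orthogonal_mod :: "'a::comm_ring_1 set \<Rightarrow> 'a set \<Rightarrow> bool" where
  "orthogonal_mod I A \<longleftrightarrow> A \<inter> I = {} \<and> (\<forall>a\<in>A. \<forall>b\<in>A. a \<noteq> b \<longrightarrow> a * b \<in> I)"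

lemma mult_prod_cong_power:
  assumes I: "is_ideal I" and "finite S" and "\<And>i. i \<in> S \<Longrightarrow> a * r i - a\<^sup>2 \<in> I"
  shows "a * prod r S - a ^ (card S + 1) \<in> I"
  using assms(2,3)
proof (induction S rule: finite_induct)
  case empty
  then show ?case by (simp add: ideal_zero[OF I])
next
  case (insert i S)
  have "r i * (a * prod r S - a ^ (card S + 1)) + a ^ card S * (a * r i - a\<^sup>2) \<in> I"
    using insert by (intro ideal_add ideal_mult_left I) auto
  also have "r i * (a * prod r S - a ^ (card S + 1)) + a ^ card S * (a * r i - a\<^sup>2)
      = a * prod r (insert i S) - a ^ (card (insert i S) + 1)"
    using insert by (simp add: algebra_simps power2_eq_square)
  finally show ?case .
qed

text \<open>Modulo \<open>I\<close>, each member \<open>b\<close> of an orthogonal set kills the sum of the others and multiplies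
  any sum containing \<open>b\<close> to \<open>b\<^sup>2\<close>. Take \<open>n + 1\<close> members and the \<open>n + 1\<close> sums that
  omit one of them. The product of all these sums is killed by every member, hence by itself, so it
  lies in the radical ideal \<open>I\<close>; dropping the sum that omits \<open>b\<close> leaves a product that
  becomes a power of \<open>b\<close> after multiplication by \<open>b\<close>, and so lies outside \<open>I\<close>.\<close>

lemma card_orthogonal_le:
  assumes rad: "radical_ideal I" and abs: "n_absorbing n I"
    and fin: "finite A" and orth: "orthogonal_mod I A"
  shows "card A \<le> n"
proof (rule ccontr)
  note I = radical_ideal_is_ideal[OF rad]
  assume "\<not> card A \<le> n"
  then have "n + 1 \<le> card A" by simp
  then obtain B where B: "B \<subseteq> A" "card B = n + 1" "finite B"
    by (rule obtain_subset_with_card_n)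
  obtain h where h: "bij_betw h {1..n+1} B"
    using finite_same_card_bij[of "{1..n+1}" B] B(2,3) by auto
  have hB: "h i \<in> B" if "i \<in> {1..n+1}" for i
    using h that by (rule bij_betw_apply)
  have notin: "b \<notin> I" if "b \<in> B" for b
    using orth B(1) that by (auto simp: orthogonal_mod_def)
  have mult: "a * b \<in> I" if "a \<in> B" "b \<in> B" "a \<noteq> b" for a b
    using orth B(1) that by (auto simp: orthogonal_mod_def)
  define r where "r i = \<Sum>(B - {h i})" for i
  define p where "p = prod r {1..n+1}"
  have kill: "b * p \<in> I" if b: "b \<in> B" for b
  proof -
    obtain i where i: "i \<in> {1..n+1}" "h i = b"
      using h b by (auto simp: bij_betw_def)
    have "b * r i \<in> I"
      unfolding r_def sum_distrib_left using i b by (intro ideal_sum I mult) auto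
    moreover have "b * p = (b * r i) * prod r ({1..n+1} - {i})"
      unfolding p_def by (subst prod.remove[OF _ i(1)]) (simp_all add: mult.assoc)
    ultimately show ?thesis
      by (simp add: ideal_mult_right I)
  qed
  have "r 1 * p \<in> I"
    unfolding r_def sum_distrib_right using kill by (intro ideal_sum I) auto
  moreover have "p = r 1 * prod r ({1..n+1} - {1})"
    unfolding p_def by (rule prod.remove) auto
  ultimately have "p ^ 2 \<in> I"
    using ideal_mult_right[OF I, of "r 1 * p" "prod r ({1..n+1} - {1})"]
    by (metis power2_eq_square mult.commute mult.assoc)
  then have "p \<in> I"
    using rad radical_ideal_powerD by (metis zero_less_numeral)
  then obtain S where S: "S \<subseteq> {1..n+1}" "card S = n" "prod r S \<in> I"
    using abs unfolding n_absorbing_def p_def by blast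
  have "S \<noteq> {1..n+1}"
  proof
    assume "S = {1..n+1}"
    then have "card S = n + 1" by simp
    with S(2) show False by simp
  qed
  then obtain k where k: "k \<in> {1..n+1}" "k \<notin> S"
    using S(1) by blast
  define a where "a = h k"
  have aB: "a \<in> B"
    using hB k a_def by simp
  have "a * r i - a\<^sup>2 \<in> I" if i: "i \<in> S" for i
  proof -
    have "a \<noteq> h i"
      using h i k S(1) unfolding a_def bij_betw_def inj_on_def by blast
    then have "r i = a + \<Sum>(B - {h i} - {a})"
      unfolding r_def using aB B(3) by (intro sum.remove) auto
    then have "a * r i - a\<^sup>2 = (\<Sum>b\<in>B - {h i} - {a}. a * b)"
      by (simp add: algebra_simps power2_eq_square sum_distrib_left)
    also have "\<dots> \<in> I"
      using aB by (intro ideal_sum I mult) auto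
    finally show ?thesis .
  qed
  then have "a * prod r S - a ^ (card S + 1) \<in> I"
    using S(1) finite_subset by (intro mult_prod_cong_power I) blast+
  then have "a * prod r S - (a * prod r S - a ^ (card S + 1)) \<in> I"
    by (rule ideal_diff[OF I ideal_mult_left[OF I S(3)]])
  then have "a ^ (card S + 1) \<in> I"
    by (simp only: diff_diff_eq2 add_diff_cancel_left')
  then have "a \<in> I"
    using rad radical_ideal_powerD by (metis zero_less_Suc Suc_eq_plus1)
  then show False
    using notin aB by blast
qed

text \<open>An orthogonal set \<open>A\<close> of largest size cannot be enlarged. If \<open>x * y\<close> kills \<open>a \<in> A\<close> modulo \<open>I\<close>
  but neither \<open>x\<close> nor \<open>y\<close> does, replacing \<open>a\<close> by \<open>x * a\<close> and \<open>y * a\<close> would enlarge it,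
  and if \<open>x \<notin> I\<close> kills all of \<open>A\<close>, inserting \<open>x\<close> would.\<close>

lemma radical_n_absorbing_Inter_primes:
  fixes I :: "'a::comm_ring_1 set"
  assumes rad: "radical_ideal I" and abs: "n_absorbing n I"
  obtains F where "finite F" and "F \<noteq> {}" and "card F \<le> n"
    and "\<And>P. P \<in> F \<Longrightarrow> is_prime_ideal P" and "I = \<Inter>F"
proof -
  note I = radical_ideal_is_ideal[OF rad]
  have proper: "I \<noteq> UNIV"
    using abs by (simp add: n_absorbing_def)
  have sq: "x \<in> I" if "x * x \<in> I" for x
    using radical_ideal_powerD[OF rad, of x 2] that by (simp add: power2_eq_square)
  define orth where "orth A \<longleftrightarrow> finite A \<and> orthogonal_mod I A" for A
  have "orth {}"
    by (simp add: orth_def orthogonal_mod_def)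
  moreover have "card A < n + 1" if "orth A" for A
    using card_orthogonal_le[OF rad abs, of A] that by (simp add: orth_def)
  ultimately obtain A where A: "orth A" and "\<And>B. orth B \<Longrightarrow> card B \<le> card A"
    using ex_has_greatest_nat[of orth "{}" card "n + 1"] by (metis less_imp_le)
  then have max: "\<not> orth B" if "card B > card A" for B
    using that not_le by blast
  have fin: "finite A" and notin: "\<And>a. a \<in> A \<Longrightarrow> a \<notin> I"
    and mult: "\<And>a b. a \<in> A \<Longrightarrow> b \<in> A \<Longrightarrow> a \<noteq> b \<Longrightarrow> a * b \<in> I"
    using A by (auto simp: orth_def orthogonal_mod_def)
  define colon where "colon a = {x. x * a \<in> I}" for a
  have prime: "is_prime_ideal (colon a)" if a: "a \<in> A" for a
  proof -
    have "is_ideal (colon a)"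
      unfolding is_ideal_iff colon_def
      using I by (auto simp: distrib_right mult.assoc ideal_zero ideal_add ideal_mult_left)
    moreover have "colon a \<noteq> UNIV"
    proof
      assume "colon a = UNIV"
      then have "1 \<in> colon a" by simp
      then show False
        using notin[OF a] by (simp add: colon_def)
    qed
    moreover have "x \<in> colon a \<or> y \<in> colon a" if xy: "x * y \<in> colon a" for x y
    proof (rule ccontr)
      assume "\<not> (x \<in> colon a \<or> y \<in> colon a)"
      then have x: "x * a \<notin> I" and y: "y * a \<notin> I"
        by (auto simp: colon_def)
      have "(x * y * a) * a \<in> I"
        using xy by (simp add: colon_def ideal_mult_right[OF I])
      then have xya: "(x * a) * (y * a) \<in> I"
        by (simp add: mult_ac)
      then have ne: "x * a \<noteq> y * a"
        using sq x by metis
      have old: "(z * a) * b \<in> I" if "b \<in> A - {a}" for b z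
        using ideal_mult_left[OF I mult[of a b], of z] that a by (auto simp: mult.assoc)
      have new: "x * a \<notin> A - {a}" "y * a \<notin> A - {a}"
        using old[of "x * a" x] old[of "y * a" y] sq x y by blast+
      let ?B = "insert (x * a) (insert (y * a) (A - {a}))"
      have "card ?B = card (A - {a}) + 2"
        using fin ne new by simp
      then have "card ?B > card A"
        using fin a by (simp add: card_Suc_Diff1 del: card_Diff_insert)
      moreover have "orth ?B"
        using fin notin x y xya xya[unfolded mult.commute[of "x * a"]]
          old old[unfolded mult.commute[of "_ * a"]] mult
        unfolding orth_def orthogonal_mod_def by auto
      ultimately show False
        using max by blast
    qed
    ultimately show ?thesis
      by (simp add: is_prime_ideal_def)
  qed
  have Inter: "I = \<Inter>(colon ` A)"
  proof
    show "I \<subseteq> \<Inter>(colon ` A)"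
      using I by (auto simp: colon_def ideal_mult_right)
    show "\<Inter>(colon ` A) \<subseteq> I"
    proof
      fix x assume "x \<in> \<Inter>(colon ` A)"
      then have xA: "\<And>a. a \<in> A \<Longrightarrow> x * a \<in> I"
        by (auto simp: colon_def)
      show "x \<in> I"
      proof (rule ccontr)
        assume x: "x \<notin> I"
        then have "x \<notin> A"
          using xA sq by blast
        then have "card (insert x A) > card A"
          using fin by simp
        moreover have "orth (insert x A)"
          using fin notin mult x xA by (auto simp: orth_def orthogonal_mod_def mult.commute)
        ultimately show False
          using max by blast
      qed
    qed
  qed
  have "card (colon ` A) \<le> n"
    using card_image_le[OF fin, of colon] card_orthogonal_le[OF rad abs, of A] A
    by (simp add: orth_def)
  moreover have "colon ` A \<noteq> {}"
    using Inter proper by auto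
  ultimately show thesis
    using that[of "colon ` A"] fin prime Inter by blast
qed

section \<open>Power series, polynomials and constants\<close>

lemma is_ideal_fps_ideal: "is_ideal I \<Longrightarrow> is_ideal (fps_ideal I)"
  unfolding is_ideal_iff[of "fps_ideal I"]
  by (auto simp: fps_ideal_def fps_mult_nth ideal_zero ideal_add
      intro!: ideal_sum ideal_mult_left)

text \<open>If the first coefficients outside \<open>P\<close> sit in degrees \<open>i\<close> and \<open>j\<close>, then modulo \<open>P\<close> only their
  product contributes to the coefficient of degree \<open>i + j\<close>.\<close>

lemma is_prime_ideal_fps_ideal:
  fixes P :: "'a::comm_ring_1 set"
  assumes P: "is_prime_ideal P"
  shows "is_prime_ideal (fps_ideal P)"
proof -
  have I: "is_ideal P"
    using P by (simp add: is_prime_ideal_def)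
  have "fps_nth 1 0 \<notin> P"
    using ideal_one_notin P by (auto simp: is_prime_ideal_def)
  then have "fps_ideal P \<noteq> UNIV"
    unfolding fps_ideal_def by blast
  moreover have "f \<in> fps_ideal P \<or> g \<in> fps_ideal P" if fg: "f * g \<in> fps_ideal P" for f g
  proof (rule ccontr)
    assume "\<not> (f \<in> fps_ideal P \<or> g \<in> fps_ideal P)"
    then have exf: "\<exists>i. fps_nth f i \<notin> P" and exg: "\<exists>j. fps_nth g j \<notin> P"
      by (auto simp: fps_ideal_def)
    define i where "i = (LEAST i. fps_nth f i \<notin> P)"
    define j where "j = (LEAST j. fps_nth g j \<notin> P)"
    have i: "fps_nth f i \<notin> P" "\<And>k. k < i \<Longrightarrow> fps_nth f k \<in> P"
      using LeastI_ex[OF exf] not_less_Least unfolding i_def by blast+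
    have j: "fps_nth g j \<notin> P" "\<And>k. k < j \<Longrightarrow> fps_nth g k \<in> P"
      using LeastI_ex[OF exg] not_less_Least unfolding j_def by blast+
    let ?t = "\<lambda>k. fps_nth f k * fps_nth g (i + j - k)"
    have "?t k \<in> P" if k: "k \<in> {0..i+j} - {i}" for k
    proof (cases "k < i")
      case True
      then show ?thesis by (simp add: i ideal_mult_right I)
    next
      case False
      then have "i + j - k < j" using k by auto
      then show ?thesis by (simp add: j ideal_mult_left I)
    qed
    then have rest: "sum ?t ({0..i+j} - {i}) \<in> P"
      by (intro ideal_sum I)
    have "fps_nth (f * g) (i + j) = ?t i + sum ?t ({0..i+j} - {i})"
      unfolding fps_mult_nth by (rule sum.remove) auto
    moreover have "fps_nth (f * g) (i + j) \<in> P"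
      using fg by (simp add: fps_ideal_def)
    ultimately have "fps_nth f i * fps_nth g j \<in> P"
      using ideal_diff[OF I _ rest] by (metis add_diff_cancel_right' add_diff_cancel_left')
    then show False
      using P i(1) j(1) by (auto simp: is_prime_ideal_def)
  qed
  ultimately show ?thesis
    by (simp add: is_prime_ideal_def is_ideal_fps_ideal I)
qed

lemma n_absorbing_fps_ideal:
  assumes "radical_ideal I" and "n_absorbing n I"
  shows "n_absorbing n (fps_ideal I)"
proof -
  obtain F where F: "finite F" "F \<noteq> {}" "card F \<le> n"
      "\<And>P. P \<in> F \<Longrightarrow> is_prime_ideal P" "I = \<Inter>F"
    using radical_n_absorbing_Inter_primes[OF assms] by blast
  have "card (fps_ideal ` F) \<le> n"
    using card_image_le[OF F(1), of fps_ideal] F(3) by simp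
  then have "n_absorbing n (\<Inter>(fps_ideal ` F))"
    using F by (intro Inter_primes_n_absorbing) (auto intro: is_prime_ideal_fps_ideal)
  also have "\<Inter>(fps_ideal ` F) = fps_ideal I"
    using F(5) by (auto simp: fps_ideal_def)
  finally show ?thesis .
qed

lemma n_absorbing_vimage:
  fixes \<phi> :: "'a::comm_ring_1 \<Rightarrow> 'b::comm_ring_1"
  assumes J: "n_absorbing n J"
    and hom: "\<phi> 0 = 0" "\<phi> 1 = 1" "\<And>x y. \<phi> (x + y) = \<phi> x + \<phi> y" "\<And>x y. \<phi> (x * y) = \<phi> x * \<phi> y"
  shows "n_absorbing n (\<phi> -` J)"
proof -
  have prod: "\<phi> (prod r S) = (\<Prod>i\<in>S. \<phi> (r i))" for r and S :: "nat set"
    by (induction S rule: infinite_finite_induct) (simp_all add: hom)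
  have "is_ideal J" "J \<noteq> UNIV"
    using J by (auto simp: n_absorbing_def)
  then have "is_ideal (\<phi> -` J)" and "1 \<notin> \<phi> -` J"
    using ideal_one_notin by (auto simp: is_ideal_iff hom)
  moreover have "\<exists>S\<subseteq>{1..n+1}. card S = n \<and> prod r S \<in> \<phi> -` J"
    if "prod r {1..n+1} \<in> \<phi> -` J" for r
    using J that unfolding n_absorbing_def vimage_eq prod by blast
  ultimately show ?thesis
    using J unfolding n_absorbing_def by blast
qed

lemma n_absorbing_fps_ideal_imp_poly_ideal:
  assumes "n_absorbing n (fps_ideal I)"
  shows "n_absorbing n (poly_ideal I)"
proof -
  have "poly_ideal I = fps_of_poly -` fps_ideal I"
    by (auto simp: poly_ideal_def fps_ideal_def)
  then show ?thesis
    using n_absorbing_vimage[OF assms, of fps_of_poly]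
    by (simp add: fps_of_poly_add fps_of_poly_mult)
qed

lemma n_absorbing_poly_ideal_imp:
  assumes I: "is_ideal I" and "n_absorbing n (poly_ideal I)"
  shows "n_absorbing n I"
proof -
  have "I = (\<lambda>a. [:a:]) -` poly_ideal I"
    using ideal_zero[OF I]
    by (auto simp: poly_ideal_def coeff_pCons split: nat.split)
  then show ?thesis
    using n_absorbing_vimage[OF assms(2), of "\<lambda>a. [:a:]"] by (simp add: one_pCons)
qed

theorem corollary26:
  fixes I :: "'a::idom set"
  assumes "radical_ideal I"
    and "prufer_domain TYPE('a) \<or> (torsion_free TYPE('a) \<and> valuation_ring TYPE('a))"
  shows "omega (fps_ideal I) = omega (poly_ideal I) \<and> omega (poly_ideal I) = omega I"
proof -
  have "n_absorbing n (fps_ideal I) \<longleftrightarrow> n_absorbing n I"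
    and "n_absorbing n (poly_ideal I) \<longleftrightarrow> n_absorbing n I" for n
    using n_absorbing_fps_ideal[OF assms(1)] n_absorbing_fps_ideal_imp_poly_ideal
      n_absorbing_poly_ideal_imp[OF radical_ideal_is_ideal[OF assms(1)]]
    by blast+
  then show ?thesis
    by (simp add: omega_def)
qed

end
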